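(* Let $N_\alpha$ be a homogeneous Poisson process with rate $\lambda_\alpha>0$ and let $\mathfrak{N}$ be an independent non-homogeneous Poisson process with rate function $\lambda(t)$, $t>0$. Then for every $t>0$, $$\mathbb{E}u^{N_\alpha(\mathfrak{N}(t))}=\exp\left\{\left[e^{\lambda_\alpha(u-1)}-1\right]\int_0^t\lambda(w)\,\mathrm dw\right\},\qquad |u|\le1,$$ and $$N_\alpha(\mathfrak{N}(t))\overset{d}{=}\sum_{j=1}^{\mathfrak{N}(t)}X_j,$$ where $X_1,X_2,\dots$ are independent Poisson random variables of parameter $\lambda_\alpha$, independent of $\mathfrak{N}$.
   Context: The rate function $\lambda(\cdot)$ is non-negative and locally integrable on $[0,\infty)$, and $\mathfrak{N}(t)$ is Poisson distributed with mean $\int_0^t\lambda(w)\,\mathrm dw$. $\overset{d}{=}$ denotes equality in distribution for each fixed $t$; an empty sum equals $0$. *)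

theory Defs
  imports "HOL-Probability.Probability"
begin

text \<open>
  The library's \<^const>\<open>poisson_pmf\<close> is specified only for positive means. A rate function may
  vanish on an interval, so mean 0 has to be included; the law is then concentrated at 0.
\<close>

definition poisson_law :: "real \<Rightarrow> nat pmf" where
  "poisson_law m = (if 0 < m then poisson_pmf m else return_pmf 0)"

lemma pmf_poisson_law:
  "0 \<le> m \<Longrightarrow> pmf (poisson_law m) k = m ^ k / fact k * exp (- m)"
  by (cases k) (auto simp: poisson_law_def)

context prob_space
begin

definition has_poisson_law :: "('a \<Rightarrow> nat) \<Rightarrow> real \<Rightarrow> bool" where
  "has_poisson_law X m \<longleftrightarrow>
     random_variable (count_space UNIV) X \<and>
     distr M (count_space UNIV) X = measure_pmf (poisson_law m)"

definition eq_in_distribution :: "'b measure \<Rightarrow> ('a \<Rightarrow> 'b) \<Rightarrow> ('a \<Rightarrow> 'b) \<Rightarrow> bool" where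
  "eq_in_distribution S X Y \<longleftrightarrow>
     random_variable S X \<and> random_variable S Y \<and> distr M S X = distr M S Y"

text \<open>
  Only the times \<open>t \<ge> 0\<close> are relevant. The subtraction in the increments is the truncated one on
  the natural numbers; by monotonicity of the paths it almost surely agrees with the true one.
\<close>

definition counting_process :: "(real \<Rightarrow> 'a \<Rightarrow> nat) \<Rightarrow> bool" where
  "counting_process N \<longleftrightarrow>
     (\<forall>t\<ge>0. random_variable (count_space UNIV) (N t)) \<and>
     (AE \<omega> in M. N 0 \<omega> = 0 \<and> mono_on {0..} (\<lambda>t. N t \<omega>) \<and>
        (\<forall>t\<ge>0. continuous (at_right t) (\<lambda>s. N s \<omega>)))"

definition independent_increments :: "(real \<Rightarrow> 'a \<Rightarrow> nat) \<Rightarrow> bool" where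
  "independent_increments N \<longleftrightarrow>
     (\<forall>n (t :: nat \<Rightarrow> real). 0 \<le> t 0 \<longrightarrow> mono_on {..n} t \<longrightarrow>
        indep_vars (\<lambda>_. count_space UNIV) (\<lambda>i \<omega>. N (t (Suc i)) \<omega> - N (t i) \<omega>) {..<n})"

definition poisson_process_with_mean :: "(real \<Rightarrow> real) \<Rightarrow> (real \<Rightarrow> 'a \<Rightarrow> nat) \<Rightarrow> bool" where
  "poisson_process_with_mean \<Lambda> N \<longleftrightarrow>
     counting_process N \<and> independent_increments N \<and>
     (\<forall>s t. 0 \<le> s \<longrightarrow> s \<le> t \<longrightarrow> has_poisson_law (\<lambda>\<omega>. N t \<omega> - N s \<omega>) (\<Lambda> t - \<Lambda> s))"

definition homogeneous_poisson_process :: "real \<Rightarrow> (real \<Rightarrow> 'a \<Rightarrow> nat) \<Rightarrow> bool" where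
  "homogeneous_poisson_process c N \<longleftrightarrow> poisson_process_with_mean (\<lambda>t. c * t) N"

definition nonhomogeneous_poisson_process ::
    "(real \<Rightarrow> real) \<Rightarrow> (real \<Rightarrow> 'a \<Rightarrow> nat) \<Rightarrow> bool" where
  "nonhomogeneous_poisson_process r N \<longleftrightarrow>
     poisson_process_with_mean (\<lambda>t. LINT w:{0..t}|lebesgue. r w) N"

definition generated_sigma :: "'i set \<Rightarrow> ('i \<Rightarrow> 'a \<Rightarrow> nat) \<Rightarrow> 'a set set" where
  "generated_sigma I X = sigma_sets (space M) {X i -` A \<inter> space M | i A. i \<in> I}"

text \<open>
  The library's \<^const>\<open>indep_var\<close> requires both random elements to have the same value type, so
  independence of two families with different index types is stated through the generated
  sigma-algebras.
\<close>

definition indep_families ::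
    "'i set \<Rightarrow> ('i \<Rightarrow> 'a \<Rightarrow> nat) \<Rightarrow> 'j set \<Rightarrow> ('j \<Rightarrow> 'a \<Rightarrow> nat) \<Rightarrow> bool" where
  "indep_families I X J Y \<longleftrightarrow> indep_set (generated_sigma I X) (generated_sigma J Y)"

end

end

(*
  Conditioning on an independent random index K gives E f(Y_K) = sum_n P(K = n) E f(Y_n).
  For Y_n = N_alpha(n) and K = N(t), and f a power function, E u^(Y_n) = v^n with
  v = exp(lam_alpha (u - 1)), so the composed generating function is that of K at v; here
  |v| <= 1 because Re u <= 1. For f the indicator of a point, the formula shows that the law
  of Y_K depends only on the laws of K and of the Y_n, and N_alpha(n) and X_1 + ... + X_n are
  both Poisson with mean lam_alpha n.
*)
theory Submission
  imports Defs
begin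

section \<open>Probability generating function of a Poisson law\<close>

lemma integral_power_poisson_law:
  fixes u :: complex
  assumes "0 \<le> m"
  shows "(LINT k|poisson_law m. u ^ k) = exp (of_real m * (u - 1))"
proof -
  \<comment> \<open>This is the exponential series at \<open>m * u\<close>, scaled by
    \<open>exp (- m)\<close>; its terms turn out to be the point masses times \<open>u ^ k\<close>,
    also for mean 0 since \<open>0 ^ 0 = 1\<close>.\<close>
  have "(\<lambda>k. (of_real m * u) ^ k /\<^sub>R fact k * exp (- of_real m))
      sums (exp (of_real m * u) * exp (- of_real m))"
    by (intro sums_mult2 exp_converges)
  moreover have "(of_real m * u) ^ k /\<^sub>R fact k * exp (- of_real m) = pmf (poisson_law m) k *\<^sub>R u ^ k" for k
    by (simp add: pmf_poisson_law assms scaleR_conv_of_real power_mult_distrib field_simps exp_of_real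
        flip: of_real_minus)
  ultimately have sums: "(\<lambda>k. pmf (poisson_law m) k *\<^sub>R u ^ k) sums exp (of_real m * (u - 1))"
    by (simp add: ring_distribs flip: exp_add)
  \<comment> \<open>Absolute convergence, from the same series at \<open>m * norm u\<close>, is what
    identifies the sum of the series with an integral over the counting measure.\<close>
  have "summable (\<lambda>k. norm ((m * norm u) ^ k /\<^sub>R fact k) * exp (- m))"
    by (intro summable_mult2 summable_norm_exp)
  then have "summable (\<lambda>k. norm (pmf (poisson_law m) k *\<^sub>R u ^ k))"
    using assms by (simp add: pmf_poisson_law power_mult_distrib norm_power norm_mult field_simps)
  then have "integrable (count_space UNIV) (\<lambda>k. pmf (poisson_law m) k *\<^sub>R u ^ k)"
    by (simp add: integrable_count_space_nat_iff)
  then have "(\<integral>k. pmf (poisson_law m) k *\<^sub>R u ^ k \<partial>count_space UNIV) = exp (of_real m * (u - 1))"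
    using sums_integral_count_space_nat sums sums_unique2 by blast
  then show ?thesis
    by (simp add: measure_pmf_eq_density integral_density)
qed

section \<open>Point masses and sums of independent Poisson variables\<close>

context prob_space
begin

text \<open>On a countable space the point masses determine a measure. \<open>P\<close> is kept
  general because it is later a Poisson law in one place and the distribution of another variable in
  another.\<close>

lemma distr_count_space_eqI:
  fixes X :: "'a \<Rightarrow> nat"
  assumes X: "random_variable (count_space UNIV) X"
    and P: "sets P = UNIV" "finite_measure P"
    and eq: "\<And>k. prob {\<omega> \<in> space M. X \<omega> = k} = measure P {k}"
  shows "distr M (count_space UNIV) X = P"
proof (rule measure_eqI_countable[where A = UNIV])
  fix k
  interpret P: finite_measure P by fact
  have "X -` {k} \<inter> space M = {\<omega> \<in> space M. X \<omega> = k}"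
    by auto
  then show "emeasure (distr M (count_space UNIV) X) {k} = emeasure P {k}"
    using X eq by (simp add: emeasure_distr emeasure_eq_measure P.emeasure_eq_measure)
qed (use P in auto)

lemma has_poisson_law_iff:
  assumes "0 \<le> m"
  shows "has_poisson_law X m \<longleftrightarrow> random_variable (count_space UNIV) X \<and>
    (\<forall>k. prob {\<omega> \<in> space M. X \<omega> = k} = m ^ k / fact k * exp (- m))"
proof -
  have "distr M (count_space UNIV) X = measure_pmf (poisson_law m) \<longleftrightarrow>
      (\<forall>k. prob {\<omega> \<in> space M. X \<omega> = k} = m ^ k / fact k * exp (- m))"
    if X: "random_variable (count_space UNIV) X"
  proof
    assume eq: "distr M (count_space UNIV) X = measure_pmf (poisson_law m)"
    show "\<forall>k. prob {\<omega> \<in> space M. X \<omega> = k} = m ^ k / fact k * exp (- m)"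
    proof
      fix k
      have "prob {\<omega> \<in> space M. X \<omega> = k} = measure (distr M (count_space UNIV) X) {k}"
        using X by (subst measure_distr) (auto intro!: arg_cong[where f = prob])
      then show "prob {\<omega> \<in> space M. X \<omega> = k} = m ^ k / fact k * exp (- m)"
        by (simp add: eq measure_pmf_single pmf_poisson_law assms)
    qed
  next
    assume "\<forall>k. prob {\<omega> \<in> space M. X \<omega> = k} = m ^ k / fact k * exp (- m)"
    then show "distr M (count_space UNIV) X = measure_pmf (poisson_law m)"
      by (intro distr_count_space_eqI X)
        (auto simp: measure_pmf_single pmf_poisson_law assms measure_pmf.finite_measure_axioms)
  qed
  then show ?thesis
    by (auto simp: has_poisson_law_def)
qed

text \<open>Splitting the event by the value of \<open>X\<close> and using independence gives the
  convolution of the two laws; the factorials combine into binomial coefficients, and the binomial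
  theorem evaluates the sum.\<close>

lemma has_poisson_law_add:
  assumes X: "has_poisson_law X a" and Y: "has_poisson_law Y b" and ab: "0 \<le> a" "0 \<le> b"
    and indep: "indep_var (count_space UNIV) X (count_space UNIV) Y"
  shows "has_poisson_law (\<lambda>\<omega>. X \<omega> + Y \<omega>) (a + b)"
proof -
  have [measurable]: "random_variable (count_space UNIV) X" "random_variable (count_space UNIV) Y"
    using X Y by (auto simp: has_poisson_law_def)
  have "prob {\<omega> \<in> space M. X \<omega> + Y \<omega> = k} = (a + b) ^ k / fact k * exp (- (a + b))" for k
  proof -
    \<comment> \<open>The range \<open>i \<le> k\<close> makes the truncated subtraction
      \<open>k - i\<close> exact.\<close>
    have "{\<omega> \<in> space M. X \<omega> + Y \<omega> = k} = (\<Union>i\<le>k. {\<omega> \<in> space M. X \<omega> = i \<and> Y \<omega> = k - i})"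
      by auto
    then have "prob {\<omega> \<in> space M. X \<omega> + Y \<omega> = k}
        = (\<Sum>i\<le>k. prob {\<omega> \<in> space M. X \<omega> = i \<and> Y \<omega> = k - i})"
      by (simp only:, intro finite_measure_finite_Union) (auto simp: disjoint_family_on_def)
    also have "\<dots> = (\<Sum>i\<le>k. (a ^ i / fact i * exp (- a)) * (b ^ (k - i) / fact (k - i) * exp (- b)))"
    proof (rule sum.cong[OF refl])
      fix i
      have "prob {\<omega> \<in> space M. X \<omega> = i \<and> Y \<omega> = k - i}
          = prob ((\<lambda>x. (X x, Y x)) -` ({i} \<times> {k - i}) \<inter> space M)"
        by (intro arg_cong[where f = prob]) auto
      also have "\<dots> = prob (X -` {i} \<inter> space M) * prob (Y -` {k - i} \<inter> space M)"
        by (intro indep_varD[OF indep]) auto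
      also have "X -` {i} \<inter> space M = {\<omega> \<in> space M. X \<omega> = i}"
        by auto
      also have "Y -` {k - i} \<inter> space M = {\<omega> \<in> space M. Y \<omega> = k - i}"
        by auto
      finally show "prob {\<omega> \<in> space M. X \<omega> = i \<and> Y \<omega> = k - i}
          = (a ^ i / fact i * exp (- a)) * (b ^ (k - i) / fact (k - i) * exp (- b))"
        using X Y ab by (simp add: has_poisson_law_iff)
    qed
    also have "\<dots> = (\<Sum>i\<le>k. of_nat (k choose i) * a ^ i * b ^ (k - i)) / fact k * exp (- (a + b))"
      unfolding sum_divide_distrib sum_distrib_right
    proof (rule sum.cong[OF refl])
      fix i assume "i \<in> {..k}"
      then have "real (k choose i) = fact k / (fact i * fact (k - i))"
        by (simp add: binomial_fact)
      then show "(a ^ i / fact i * exp (- a)) * (b ^ (k - i) / fact (k - i) * exp (- b))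
          = real (k choose i) * a ^ i * b ^ (k - i) / fact k * exp (- (a + b))"
        by (simp add: exp_diff exp_minus field_simps)
    qed
    also have "\<dots> = (a + b) ^ k / fact k * exp (- (a + b))"
      by (simp add: binomial_ring)
    finally show ?thesis .
  qed
  then show ?thesis
    using ab by (simp add: has_poisson_law_iff)
qed

lemma has_poisson_law_zero: "has_poisson_law (\<lambda>\<omega>. 0) 0"
proof -
  have "prob {\<omega> \<in> space M. 0 = k} = 0 ^ k / fact k * exp (- 0)" for k :: nat
    by (cases k) (auto simp: prob_space)
  then show ?thesis
    by (simp add: has_poisson_law_iff)
qed

text \<open>The index blocks \<open>{i}\<close> and \<open>I\<close> are disjoint, so the family
  restricted to one is independent of its restriction to the other. Independence survives applying a
  map to each block, here evaluation at \<open>i\<close> and summation over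
  \<open>I\<close>.\<close>

lemma indep_var_nat_sum:
  fixes X :: "'i \<Rightarrow> 'a \<Rightarrow> nat"
  assumes I: "finite I" "i \<notin> I"
    and indep: "indep_vars (\<lambda>_. count_space UNIV) X (insert i I)"
  shows "indep_var (count_space UNIV) (X i) (count_space UNIV) (\<lambda>\<omega>. \<Sum>i\<in>I. X i \<omega>)"
proof -
  have "indep_var
    (count_space UNIV) ((\<lambda>f. f i) \<circ> (\<lambda>\<omega>. restrict (\<lambda>i. X i \<omega>) {i}))
    (count_space UNIV) ((\<lambda>f. \<Sum>i\<in>I. f i) \<circ> (\<lambda>\<omega>. restrict (\<lambda>i. X i \<omega>) I))"
    using I by (intro indep_var_compose[OF indep_var_restrict[OF indep]]) auto
  also have "(\<lambda>f. f i) \<circ> (\<lambda>\<omega>. restrict (\<lambda>i. X i \<omega>) {i}) = X i"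
    by auto
  also have "(\<lambda>f. \<Sum>i\<in>I. f i) \<circ> (\<lambda>\<omega>. restrict (\<lambda>i. X i \<omega>) I) = (\<lambda>\<omega>. \<Sum>i\<in>I. X i \<omega>)"
    by (auto cong: rev_conj_cong)
  finally show ?thesis .
qed

lemma has_poisson_law_sum:
  assumes "finite I" "indep_vars (\<lambda>_. count_space UNIV) X I" "0 \<le> c"
    and "\<And>i. i \<in> I \<Longrightarrow> has_poisson_law (X i) c"
  shows "has_poisson_law (\<lambda>\<omega>. \<Sum>i\<in>I. X i \<omega>) (c * card I)"
  using assms
proof (induction I)
  case empty
  then show ?case by (simp add: has_poisson_law_zero)
next
  case (insert i I)
  have "indep_vars (\<lambda>_. count_space UNIV) X I"
    using insert.prems(1) by (rule indep_vars_subset) auto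
  then have "has_poisson_law (\<lambda>\<omega>. X i \<omega> + (\<Sum>i\<in>I. X i \<omega>)) (c + c * card I)"
    using insert by (intro has_poisson_law_add indep_var_nat_sum) auto
  then show ?case
    using insert by (simp add: ring_distribs)
qed

section \<open>Evaluating a family of variables at an independent random index\<close>

lemma prob_eq_integral_indicator:
  assumes "random_variable (count_space UNIV) W"
  shows "prob {\<omega> \<in> space M. W \<omega> = k} = (LINT \<omega>|M. indicator {k} (W \<omega>))"
proof -
  have "(LINT \<omega>|M. indicator {k} (W \<omega>)) = (LINT \<omega>|M. indicator {\<omega> \<in> space M. W \<omega> = k} \<omega> :: real)"
    by (intro Bochner_Integration.integral_cong) (auto simp: indicator_def)
  then show ?thesis
    using Int_absorb2[of "{\<omega> \<in> space M. W \<omega> = k}" "space M"] by auto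
qed

text \<open>The integrand is split according to the value of \<open>K\<close>, each piece factors by
  independence, and boundedness of \<open>f\<close> permits exchanging sum and expectation. The
  general value field covers both real indicators and complex powers.\<close>

lemma integral_random_index_sums:
  fixes Y :: "nat \<Rightarrow> 'a \<Rightarrow> nat" and K :: "'a \<Rightarrow> nat"
    and f :: "nat \<Rightarrow> 'b::{real_normed_field, banach, second_countable_topology}"
  assumes indep: "\<And>n. indep_var (count_space UNIV) (Y n) (count_space UNIV) K"
    and bound: "\<And>k. norm (f k) \<le> B"
  shows "(\<lambda>n. of_real (prob {\<omega> \<in> space M. K \<omega> = n}) * (LINT \<omega>|M. f (Y n \<omega>)))
    sums (LINT \<omega>|M. f (Y (K \<omega>) \<omega>))"
proof -
  \<comment> \<open>The indicator is embedded into \<open>'b\<close>, so that both factors have the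
    same value type, as the product rule for expectations of independent variables requires.\<close>
  let ?g = "\<lambda>n \<omega>. f (Y n \<omega>) * of_real (indicator {n} (K \<omega>))"
  have Y[measurable]: "\<And>n. random_variable (count_space UNIV) (Y n)"
    and K[measurable]: "random_variable (count_space UNIV) K"
    using indep by (auto simp: indep_var_eq)
  have int: "integrable M (\<lambda>\<omega>. f (Y n \<omega>))" for n
    using bound by (intro integrable_const_bound[where B = B]) auto
  have intK: "integrable M (\<lambda>\<omega>. of_real (indicator {n} (K \<omega>)) :: 'b)" for n
    by (intro integrable_const_bound[where B = 1]) (auto simp: indicator_def)
  have indicator_K: "(LINT \<omega>|M. indicator {n} (K \<omega>)) = prob {\<omega> \<in> space M. K \<omega> = n}" for n
    by (rule prob_eq_integral_indicator[OF K, symmetric])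
  have int_indicator: "integrable M (\<lambda>\<omega>. indicator {n} (K \<omega>) :: real)" for n
    by (intro integrable_const_bound[where B = 1]) (auto simp: indicator_def)
  then have of_real_K: "(LINT \<omega>|M. of_real (indicator {n} (K \<omega>)))
      = (of_real (prob {\<omega> \<in> space M. K \<omega> = n}) :: 'b)" for n
    unfolding indicator_K[symmetric] by (rule integral_bounded_linear[OF bounded_linear_of_real])
  have indep': "indep_var borel (\<lambda>\<omega>. f (Y n \<omega>)) borel (\<lambda>\<omega>. of_real (indicator {n} (K \<omega>)) :: 'b)" for n
    using indep_var_compose[OF indep, where ?Y1.0 = f and ?Y2.0 = "\<lambda>k. of_real (indicator {n} k)"
        and ?N1.0 = borel and ?N2.0 = borel]
    by (simp add: comp_def)
  have g: "(LINT \<omega>|M. ?g n \<omega>) = of_real (prob {\<omega> \<in> space M. K \<omega> = n}) * (LINT \<omega>|M. f (Y n \<omega>))" for n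
    by (subst indep_var_lebesgue_integral[OF indep' int intK]) (simp add: of_real_K mult.commute)
  have int_g: "integrable M (?g n)" for n
    by (rule indep_var_integrable[OF indep' int intK])
  \<comment> \<open>At each outcome only the summand with \<open>n = K \<omega>\<close> can be
    nonzero, so pointwise summation is trivial and recovers
    \<open>f (Y (K \<omega>) \<omega>)\<close>.\<close>
  have sum_g: "?g n \<omega> = (if n = K \<omega> then f (Y (K \<omega>) \<omega>) else 0)" for n \<omega>
    by (auto simp: indicator_def)
  have "(\<lambda>n. LINT \<omega>|M. ?g n \<omega>) sums (LINT \<omega>|M. (\<Sum>n. ?g n \<omega>))"
  proof (rule sums_integral)
    show "integrable M (?g n)" for n by (rule int_g)
    have "summable (\<lambda>n. norm (?g n \<omega>))" for \<omega>
      by (rule summable_finite[of "{K \<omega>}"]) (auto simp: indicator_def)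
    then show "AE \<omega> in M. summable (\<lambda>n. norm (?g n \<omega>))"
      by simp
    \<comment> \<open>These bounds are summable in \<open>n\<close> because the events
      \<open>K = n\<close> are disjoint; this justifies exchanging sum and integral.\<close>
    have norm_g: "(LINT \<omega>|M. norm (?g n \<omega>)) \<le> B * prob {\<omega> \<in> space M. K \<omega> = n}" for n
    proof -
      have "(LINT \<omega>|M. norm (?g n \<omega>)) \<le> (LINT \<omega>|M. B * indicator {n} (K \<omega>))"
      proof (rule integral_mono)
        show "integrable M (\<lambda>\<omega>. norm (?g n \<omega>))"
          by (rule integrable_norm[OF int_g])
        show "integrable M (\<lambda>\<omega>. B * indicator {n} (K \<omega>))"
          by (rule integrable_mult_right) (rule int_indicator)
        show "norm (?g n \<omega>) \<le> B * indicator {n} (K \<omega>)" for \<omega>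
          using bound[of "Y n \<omega>"] by (simp add: indicator_def)
      qed
      then show ?thesis
        by (simp add: indicator_K)
    qed
    have "(\<lambda>n. prob {\<omega> \<in> space M. K \<omega> = n}) sums prob (\<Union>n. {\<omega> \<in> space M. K \<omega> = n})"
      by (rule finite_measure_UNION) (auto simp: disjoint_family_on_def)
    then have "summable (\<lambda>n. B * prob {\<omega> \<in> space M. K \<omega> = n})"
      by (intro summable_mult) (rule sums_summable)
    then show "summable (\<lambda>n. LINT \<omega>|M. norm (?g n \<omega>))"
    proof (rule summable_comparison_test'[where N = 0])
      fix n
      have "0 \<le> (LINT \<omega>|M. norm (?g n \<omega>))"
        by (rule Bochner_Integration.integral_nonneg) (rule norm_ge_zero)
      then show "norm (LINT \<omega>|M. norm (?g n \<omega>)) \<le> B * prob {\<omega> \<in> space M. K \<omega> = n}"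
        using norm_g[of n] unfolding real_norm_def by linarith
    qed
  qed
  also have "(\<lambda>\<omega>. \<Sum>n. ?g n \<omega>) = (\<lambda>\<omega>. f (Y (K \<omega>) \<omega>))"
    unfolding sum_g by (intro ext sums_unique[symmetric] sums_single)
  finally show ?thesis
    by (simp add: g)
qed

lemma integral_distr_cong:
  assumes "random_variable (count_space UNIV) X" "random_variable (count_space UNIV) Y"
    and "distr M (count_space UNIV) X = distr M (count_space UNIV) Y"
  shows "(LINT \<omega>|M. f (X \<omega>)) = (LINT \<omega>|M. f (Y \<omega>) :: 'c :: {banach, second_countable_topology})"
  using integral_distr[OF assms(1), of f] integral_distr[OF assms(2), of f] assms(3) by simp

text \<open>With \<open>f\<close> the indicator of a point, the two point masses are limits of
  series that agree term by term. The comparison is made separately for each \<open>n\<close>, so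
  the joint behaviour of the \<open>Y n\<close> over different \<open>n\<close> never
  enters.\<close>

lemma eq_in_distribution_random_index:
  fixes Y Z :: "nat \<Rightarrow> 'a \<Rightarrow> nat"
  assumes Y: "\<And>n. indep_var (count_space UNIV) (Y n) (count_space UNIV) K"
    and Z: "\<And>n. indep_var (count_space UNIV) (Z n) (count_space UNIV) K"
    and eq: "\<And>n. distr M (count_space UNIV) (Y n) = distr M (count_space UNIV) (Z n)"
  shows "eq_in_distribution (count_space UNIV) (\<lambda>\<omega>. Y (K \<omega>) \<omega>) (\<lambda>\<omega>. Z (K \<omega>) \<omega>)"
proof -
  have rv: "\<And>n. random_variable (count_space UNIV) (Y n)"
    "\<And>n. random_variable (count_space UNIV) (Z n)"
    "random_variable (count_space UNIV) K"
    using Y Z by (auto simp: indep_var_eq)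
  \<comment> \<open>Measurability at a random index holds because \<open>K\<close> takes countably
    many values, with a measurable piece for each.\<close>
  have YK: "random_variable (count_space UNIV) (\<lambda>\<omega>. Y (K \<omega>) \<omega>)"
    and ZK: "random_variable (count_space UNIV) (\<lambda>\<omega>. Z (K \<omega>) \<omega>)"
    by (rule measurable_compose_countable[OF rv(1) rv(3)], rule measurable_compose_countable[OF rv(2) rv(3)])
  have bound: "norm (indicator {k} l :: real) \<le> 1" for k l :: nat
    by (simp add: indicator_def)
  have "(LINT \<omega>|M. indicator {k} (Y (K \<omega>) \<omega>) :: real) = (LINT \<omega>|M. indicator {k} (Z (K \<omega>) \<omega>))" for k
    using integral_random_index_sums[of Y K "indicator {k}" 1, OF Y bound]
      integral_random_index_sums[of Z K "indicator {k}" 1, OF Z bound]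
      integral_distr_cong[OF rv(1) rv(2) eq]
    by (metis (no_types, lifting) ext sums_unique2)
  then have "prob {\<omega> \<in> space M. Y (K \<omega>) \<omega> = k} = prob {\<omega> \<in> space M. Z (K \<omega>) \<omega> = k}" for k
    using YK ZK by (simp add: prob_eq_integral_indicator)
  moreover have "prob {\<omega> \<in> space M. Z (K \<omega>) \<omega> = k}
      = measure (distr M (count_space UNIV) (\<lambda>\<omega>. Z (K \<omega>) \<omega>)) {k}" for k
    using ZK by (subst measure_distr) (auto intro!: arg_cong[where f = prob])
  ultimately have "distr M (count_space UNIV) (\<lambda>\<omega>. Y (K \<omega>) \<omega>)
      = distr M (count_space UNIV) (\<lambda>\<omega>. Z (K \<omega>) \<omega>)"
    using YK ZK
    by (intro distr_count_space_eqI) (auto intro: finite_measure_distr)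
  then show ?thesis
    using YK ZK by (simp add: eq_in_distribution_def)
qed

text \<open>The expectation of \<open>u ^ Y n\<close> is \<open>exp (c * n * (u - 1))\<close>, the
  \<open>n\<close>-th power of a number \<open>v\<close> not depending on \<open>n\<close>. The
  series over the values of \<open>K\<close> is thus the generating function of \<open>K\<close> at
  \<open>v\<close>, to which the Poisson formula applies a second time.\<close>

lemma integral_power_random_index:
  fixes u :: complex
  assumes Y: "\<And>n. indep_var (count_space UNIV) (Y n) (count_space UNIV) K"
    and law: "\<And>n. has_poisson_law (Y n) (c * real n)" "has_poisson_law K m"
    and cm: "0 \<le> c" "0 \<le> m"
    and u: "cmod u \<le> 1"
  shows "(LINT \<omega>|M. u ^ Y (K \<omega>) \<omega>) = exp ((exp (of_real c * (u - 1)) - 1) * of_real m)"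
proof -
  define v where "v = exp (of_real c * (u - 1))"
  have pgf: "(LINT \<omega>|M. w ^ X \<omega>) = exp (of_real b * (w - 1))"
    if "has_poisson_law X b" "0 \<le> b" for X b and w :: complex
    using that integral_distr[of X M "count_space UNIV" "\<lambda>k. w ^ k"]
    by (auto simp: has_poisson_law_def integral_power_poisson_law)
  \<comment> \<open>The modulus of \<open>v\<close> is \<open>exp (c * (Re u - 1))\<close>, hence at
    most 1; this gives the bound on the powers of \<open>v\<close> needed for the second
    series.\<close>
  have "Re u \<le> 1"
    using u complex_Re_le_cmod order_trans by blast
  then have v: "cmod v \<le> 1"
    using cm by (simp add: v_def mult_nonneg_nonpos)
  have pow_le: "norm (w ^ k) \<le> 1" if "cmod w \<le> 1" for w :: complex and k
    using that by (simp add: norm_power power_le_one)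
  have "(LINT \<omega>|M. u ^ Y n \<omega>) = v ^ n" for n
    using pgf[OF law(1), of n u] cm by (simp add: v_def ac_simps flip: exp_of_nat_mult)
  then have "(\<lambda>n. of_real (prob {\<omega> \<in> space M. K \<omega> = n}) * v ^ n) sums (LINT \<omega>|M. u ^ Y (K \<omega>) \<omega>)"
    using integral_random_index_sums[of Y K "\<lambda>k. u ^ k" 1, OF Y pow_le[OF u]] by simp
  \<comment> \<open>The same series formula is applied to the constant variables \<open>n\<close>,
    whose value at the random index is \<open>K\<close> itself. Their independence of
    \<open>K\<close> comes from composing \<open>Y 0\<close> with a constant map.\<close>
  moreover have "(\<lambda>n. of_real (prob {\<omega> \<in> space M. K \<omega> = n}) * v ^ n) sums (LINT \<omega>|M. v ^ K \<omega>)"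
  proof -
    have "indep_var (count_space UNIV) (\<lambda>_. n) (count_space UNIV) K" for n :: nat
      using indep_var_compose[OF Y[of 0], of "\<lambda>_. n" "count_space UNIV" id "count_space UNIV"]
      by (simp add: comp_def)
    then show ?thesis
      using integral_random_index_sums[of "\<lambda>n _. n" K "\<lambda>k. v ^ k" 1, OF _ pow_le[OF v]]
      by (simp add: prob_space)
  qed
  ultimately have "(LINT \<omega>|M. u ^ Y (K \<omega>) \<omega>) = (LINT \<omega>|M. v ^ K \<omega>)"
    by (rule sums_unique2)
  then show ?thesis
    using pgf[OF law(2) cm(2)] by (simp add: v_def mult.commute)
qed

section \<open>From independence of families to independence of single variables\<close>

lemma sets_sigma_generated:
  fixes X :: "'i \<Rightarrow> 'a \<Rightarrow> nat"
  shows
  "sets (sigma (space M) {X i -` A \<inter> space M | i A. i \<in> I}) = generated_sigma I X"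
  unfolding generated_sigma_def by (rule sets_measure_of) auto

lemma space_sigma_generated:
  "space (sigma (space M) {X i -` A \<inter> space M | i A. i \<in> I}) = space M"
  by (rule space_measure_of) auto

text \<open>Combined with closure of measurability under finite sums, this makes partial sums of a
  family measurable for the sigma-algebra that the family generates.\<close>

lemma generated_sigma_measurable:
  fixes X :: "'i \<Rightarrow> 'a \<Rightarrow> nat"
  assumes "i \<in> I"
  shows "X i \<in> measurable (sigma (space M) {X i -` A \<inter> space M | i A. i \<in> I}) (count_space UNIV)"
proof (rule measurableI)
  fix A
  have "X i -` A \<inter> space M \<in> generated_sigma I X"
    unfolding generated_sigma_def using assms by (intro sigma_sets.Basic) auto
  then show "X i -` A \<inter> space (sigma (space M) {X i -` A \<inter> space M | i A. i \<in> I})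
      \<in> sets (sigma (space M) {X i -` A \<inter> space M | i A. i \<in> I})"
    by (simp only: sets_sigma_generated space_sigma_generated)
qed simp

text \<open>Events about \<open>Z\<close> and events about \<open>Y j\<close> lie in the two
  independent sigma-algebras, and independence passes to smaller ones. Allowing any \<open>Z\<close>
  measurable for the first covers both a process at a fixed time and a partial sum.\<close>

lemma indep_var_indep_families:
  assumes indep: "indep_families I X J Y"
    and Z: "Z \<in> measurable (sigma (space M) {X i -` A \<inter> space M | i A. i \<in> I}) (count_space UNIV)"
    and j: "j \<in> J"
  shows "indep_var (count_space UNIV) Z (count_space UNIV) (Y j)"
proof -
  have ind: "indep_set (generated_sigma I X) (generated_sigma J Y)"
    using indep by (simp add: indep_families_def)
  have Z_sub: "Z -` A \<inter> space M \<in> generated_sigma I X" for A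
    using measurable_sets[OF Z, of A] unfolding sets_sigma_generated space_sigma_generated by simp
  have Y_sub: "Y j -` A \<inter> space M \<in> generated_sigma J Y" for A
    unfolding generated_sigma_def using j by (intro sigma_sets.Basic) auto
  \<comment> \<open>Independent collections consist of events of \<open>M\<close>, so the inclusions
    above also give measurability with respect to \<open>M\<close>.\<close>
  have "random_variable (count_space UNIV) Z" "random_variable (count_space UNIV) (Y j)"
    using Z_sub Y_sub indep_setD_ev1[OF ind] indep_setD_ev2[OF ind] by (auto intro!: measurableI)
  moreover have "sigma_sets (space M) {Z -` A \<inter> space M | A. A \<in> sets (count_space UNIV)}
      \<subseteq> generated_sigma I X"
    using Z_sub unfolding generated_sigma_def by (intro sigma_sets_mono) auto
  moreover have "sigma_sets (space M) {Y j -` A \<inter> space M | A. A \<in> sets (count_space UNIV)}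
      \<subseteq> generated_sigma J Y"
    using Y_sub unfolding generated_sigma_def by (intro sigma_sets_mono) auto
  ultimately show ?thesis
    using ind unfolding indep_var_eq indep_sets2_eq by blast
qed

text \<open>Only increments have a prescribed law. Since \<open>N 0\<close> vanishes almost surely,
  \<open>N t\<close> agrees almost surely with the increment from 0 to \<open>t\<close>, and null
  sets do not affect the distribution.\<close>

lemma poisson_process_with_mean_law:
  assumes N: "poisson_process_with_mean \<Lambda> N" and "\<Lambda> 0 = 0" "0 \<le> t"
  shows "has_poisson_law (N t) (\<Lambda> t)"
proof -
  have "counting_process N"
    and increments: "\<forall>s t. 0 \<le> s \<longrightarrow> s \<le> t \<longrightarrow> has_poisson_law (\<lambda>\<omega>. N t \<omega> - N s \<omega>) (\<Lambda> t - \<Lambda> s)"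
    using N by (auto simp only: poisson_process_with_mean_def)
  then have N_t: "random_variable (count_space UNIV) (N t)" and N_0: "AE \<omega> in M. N 0 \<omega> = 0"
    using \<open>0 \<le> t\<close> by (auto simp: counting_process_def)
  have law: "has_poisson_law (\<lambda>\<omega>. N t \<omega> - N 0 \<omega>) (\<Lambda> t)"
    using increments[rule_format, of 0 t] assms(2,3) by simp
  have "distr M (count_space UNIV) (\<lambda>\<omega>. N t \<omega> - N 0 \<omega>) = distr M (count_space UNIV) (N t)"
    using law N_t N_0 by (intro distr_cong_AE) (auto simp: has_poisson_law_def)
  then show ?thesis
    using law N_t by (simp add: has_poisson_law_def)
qed

end

section \<open>Generating function and random-sum representation of the composed process\<close>

theorem mainTheorem5:
  fixes M :: "'a measure"
    and lam\<^sub>\<alpha> :: real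
    and rate :: "real \<Rightarrow> real"
    and N\<^sub>\<alpha> \<NN> :: "real \<Rightarrow> 'a \<Rightarrow> nat"
  assumes "prob_space M"
    and "0 < lam\<^sub>\<alpha>"
    and "\<And>w. 0 \<le> w \<Longrightarrow> 0 \<le> rate w"
    and "\<And>b. 0 \<le> b \<Longrightarrow> set_integrable lebesgue {0..b} rate"
    and "prob_space.homogeneous_poisson_process M lam\<^sub>\<alpha> N\<^sub>\<alpha>"
    and "prob_space.nonhomogeneous_poisson_process M rate \<NN>"
    and "prob_space.indep_families M {0..} N\<^sub>\<alpha> {0..} \<NN>"
  shows "\<forall>t>0.
      (\<forall>u::complex. cmod u \<le> 1 \<longrightarrow>
         (LINT \<omega>|M. u ^ N\<^sub>\<alpha> (real (\<NN> t \<omega>)) \<omega>) =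
           exp ((exp (of_real lam\<^sub>\<alpha> * (u - 1)) - 1) * of_real (LINT w:{0..t}|lebesgue. rate w))) \<and>
      (\<forall>X :: nat \<Rightarrow> 'a \<Rightarrow> nat.
         prob_space.indep_vars M (\<lambda>_. count_space UNIV) X {1..} \<longrightarrow>
         (\<forall>j\<ge>1. prob_space.has_poisson_law M (X j) lam\<^sub>\<alpha>) \<longrightarrow>
         prob_space.indep_families M {1..} X {0..} \<NN> \<longrightarrow>
         prob_space.eq_in_distribution M (count_space UNIV)
           (\<lambda>\<omega>. N\<^sub>\<alpha> (real (\<NN> t \<omega>)) \<omega>) (\<lambda>\<omega>. \<Sum>j = 1..\<NN> t \<omega>. X j \<omega>))"
proof -
  interpret prob_space M by fact
  let ?\<Lambda> = "\<lambda>t. LINT w:{0..t}|lebesgue. rate w"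
  \<comment> \<open>The integrand vanishes off the single point 0, which is a Lebesgue null
    set.\<close>
  have mean_0: "?\<Lambda> 0 = 0"
    unfolding set_lebesgue_integral_def
    using AE_completion[OF AE_lborel_singleton[of 0]]
    by (intro integral_eq_zero_AE) (auto elim!: eventually_mono)
  \<comment> \<open>For negative \<open>t\<close> the interval is empty; otherwise the indicator
    confines the integrand to points where the rate is non-negative.\<close>
  have mean_nonneg: "0 \<le> ?\<Lambda> t" for t
    unfolding set_lebesgue_integral_def
    using assms(3) by (intro Bochner_Integration.integral_nonneg) (auto simp: indicator_def)
  have law_\<alpha>: "has_poisson_law (N\<^sub>\<alpha> (real n)) (lam\<^sub>\<alpha> * real n)" for n
    using assms(5) by (intro poisson_process_with_mean_law) (auto simp: homogeneous_poisson_process_def)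
  have law_\<NN>: "has_poisson_law (\<NN> t) (?\<Lambda> t)" if "0 < t" for t
    using assms(6) mean_0 that
    by (intro poisson_process_with_mean_law[where \<Lambda> = ?\<Lambda>])
      (auto simp: nonhomogeneous_poisson_process_def)
  have indep_\<alpha>: "indep_var (count_space UNIV) (N\<^sub>\<alpha> (real n)) (count_space UNIV) (\<NN> t)"
    if "0 < t" for n t
    using that by (intro indep_var_indep_families[OF assms(7)] generated_sigma_measurable) auto
  have "(LINT \<omega>|M. u ^ N\<^sub>\<alpha> (real (\<NN> t \<omega>)) \<omega>)
      = exp ((exp (of_real lam\<^sub>\<alpha> * (u - 1)) - 1) * of_real (?\<Lambda> t))"
    if "0 < t" "cmod u \<le> 1" for t and u :: complex
    using assms(2) that mean_nonneg
    by (intro integral_power_random_index[where Y = "\<lambda>n. N\<^sub>\<alpha> (real n)"] indep_\<alpha> law_\<alpha> law_\<NN>) auto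
  moreover have "eq_in_distribution (count_space UNIV)
      (\<lambda>\<omega>. N\<^sub>\<alpha> (real (\<NN> t \<omega>)) \<omega>) (\<lambda>\<omega>. \<Sum>j = 1..\<NN> t \<omega>. X j \<omega>)"
    if t: "0 < t" and X: "indep_vars (\<lambda>_. count_space UNIV) X {1..}"
      "\<forall>j\<ge>1. has_poisson_law (X j) lam\<^sub>\<alpha>" "indep_families {1..} X {0..} \<NN>"
    for t and X :: "nat \<Rightarrow> 'a \<Rightarrow> nat"
  \<comment> \<open>For each \<open>n\<close>, \<open>N\<^sub>\<alpha> (real n)\<close> and the sum
    of the first \<open>n\<close> variables are both Poisson with mean
    \<open>lam\<^sub>\<alpha> * n\<close>. At \<open>n = 0\<close> the sum is empty, matching the
    point mass at 0.\<close>
  proof (rule eq_in_distribution_random_index[where Y = "\<lambda>n. N\<^sub>\<alpha> (real n)"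
          and Z = "\<lambda>n \<omega>. \<Sum>j = 1..n. X j \<omega>", OF indep_\<alpha>[OF t]])
    fix n
    have "(\<lambda>\<omega>. \<Sum>j = 1..n. X j \<omega>) \<in> measurable
        (sigma (space M) {X i -` A \<inter> space M | i A. i \<in> {1..}}) (count_space UNIV)"
      by (intro measurable_sum_nat generated_sigma_measurable) auto
    then show "indep_var (count_space UNIV) (\<lambda>\<omega>. \<Sum>j = 1..n. X j \<omega>) (count_space UNIV) (\<NN> t)"
      using t by (intro indep_var_indep_families[OF X(3)]) auto
    have "has_poisson_law (\<lambda>\<omega>. \<Sum>j = 1..n. X j \<omega>) (lam\<^sub>\<alpha> * card {1..n})"
      using X assms(2) by (intro has_poisson_law_sum indep_vars_subset[OF X(1)]) auto
    then show "distr M (count_space UNIV) (N\<^sub>\<alpha> (real n))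
        = distr M (count_space UNIV) (\<lambda>\<omega>. \<Sum>j = 1..n. X j \<omega>)"
      using law_\<alpha>[of n] by (simp add: has_poisson_law_def)
  qed
  ultimately show ?thesis
    by blast
qed

end
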